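(* There is a constant $\delta>0.058$ such that for every sufficiently large $N$ the edge set of the complete graph $K_N$ can be partitioned into the edge sets of two graphs $G_1,G_2$ (on the same vertex set), such that for each $i\in\{1,2\}$ the edge set of $G_i$ is the union of at most $N^{2-\delta}$ pairwise edge-disjoint induced matchings of $G_i$.
   Context: An induced matching in a graph $G$ is a set of pairwise vertex-disjoint edges of $G$ such that the subgraph of $G$ induced on the set of endpoints of these edges contains no other edges. "Induced" is with respect to the individual graph $G_i$. *)

theory Defs
  imports Complex_Main "HOL-Library.Ramsey"
begin

text \<open>
  A finite simple graph on a vertex set V is given by its edge set, a subset of
  \<^term>\<open>nsets V 2\<close>; the latter is the edge set of the complete graph on V.
  Isolated vertices play no role for matchings, so V is not carried along.
\<close>

definition induced_edges :: "'a set set \<Rightarrow> 'a set \<Rightarrow> 'a set set" where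
  "induced_edges E S = {e \<in> E. e \<subseteq> S}"

definition induced_matching :: "'a set set \<Rightarrow> 'a set set \<Rightarrow> bool" where
  "induced_matching E M \<longleftrightarrow>
     M \<subseteq> E \<and> pairwise disjnt M \<and> induced_edges E (\<Union>M) = M"

text \<open>
  Members of \<open>\<M>\<close> are sets of edges, so \<^term>\<open>pairwise disjnt \<M>\<close> below is
  edge-disjointness; within a single matching (above) it is vertex-disjointness.
\<close>

definition induced_matching_decomposition :: "'a set set \<Rightarrow> 'a set set set \<Rightarrow> bool" where
  "induced_matching_decomposition E \<M> \<longleftrightarrow>
     finite \<M> \<and> (\<forall>M\<in>\<M>. induced_matching E M) \<and> pairwise disjnt \<M> \<and> \<Union>\<M> = E"

end

(* Encode the vertices as distinct subsets of a set with 18m elements, i.e. as points of a Hamming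
   cube. Let G1 consist of the pairs at distance at least 7m and G2 of the remaining pairs.

   In G2, put edges {x, x+v} with the same difference v into one class. Within a class, the edge at x
   is compatible with the edge at x+u unless u or u+v lies in the Hamming ball of radius 7m, so
   greedy colouring needs at most |ball| colours; there are at most |ball| classes.

   In G1, the edges of a class share the difference v and moreover the part of x outside v, so that
   two of them differ by some u contained in v. They are compatible unless |u| or |v - u| is at least
   7m, so it takes at most as many colours as there are u contained in v with |u| <= |v| - 7m.

   Exponentially weighted counting bounds the total number of colours by b^m with
   b < 2^34.8, where N is about 2^(18m). *)
theory Submission
  imports Defs
begin

section \<open>Greedy colouring inside edge classes\<close>

text \<open>The vertex coloured last has fewer than \<open>K\<close> neighbours, so their colours
  leave one of the \<open>K\<close> values free. Loops of \<open>R\<close> are discounted by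
  \<open>y \<noteq> x\<close>, since the relation used later is reflexive on edges.\<close>

lemma greedy_colouring:
  fixes R :: "'a \<Rightarrow> 'a \<Rightarrow> bool"
  assumes "finite V" and sym: "\<And>x y. R x y \<Longrightarrow> R y x"
    and deg: "\<And>x. x \<in> V \<Longrightarrow> card {y \<in> V. y \<noteq> x \<and> R x y} < K"
  shows "\<exists>c::'a \<Rightarrow> nat. (\<forall>x\<in>V. c x < K) \<and> (\<forall>x\<in>V. \<forall>y\<in>V. x \<noteq> y \<longrightarrow> R x y \<longrightarrow> c x \<noteq> c y)"
  using assms(1) deg
proof (induction V rule: finite_induct)
  case empty
  then show ?case by simp
next
  case (insert x F)
  have "card {y \<in> F. y \<noteq> z \<and> R z y} < K" if "z \<in> F" for z
  proof -
    have "card {y \<in> F. y \<noteq> z \<and> R z y} \<le> card {y \<in> insert x F. y \<noteq> z \<and> R z y}"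
      by (rule card_mono) (use insert.hyps in auto)
    also have "\<dots> < K" using insert.prems that by blast
    finally show ?thesis .
  qed
  then obtain c :: "'a \<Rightarrow> nat" where c: "\<forall>x\<in>F. c x < K"
      "\<forall>x\<in>F. \<forall>y\<in>F. x \<noteq> y \<longrightarrow> R x y \<longrightarrow> c x \<noteq> c y"
    using insert.IH by blast
  let ?S = "{y \<in> insert x F. y \<noteq> x \<and> R x y}"
  have "card (c ` ?S) \<le> card ?S"
    by (rule card_image_le) (use insert.hyps in auto)
  also have "\<dots> < card {..<K}" using insert.prems by simp
  finally have "\<not> {..<K} \<subseteq> c ` ?S"
    using card_mono[of "c ` ?S" "{..<K}"] insert.hyps by auto
  then obtain k where k: "k < K" "k \<notin> c ` ?S" by blast
  have k': "c y \<noteq> k" if "y \<in> F" "R x y" for y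
    using k(2) that insert.hyps(2) by blast
  show ?case
  proof (intro exI conjI ballI impI)
    show "(c(x := k)) z < K" if "z \<in> insert x F" for z
      using c(1) k(1) that by auto
    show "(c(x := k)) y \<noteq> (c(x := k)) z"
      if "y \<in> insert x F" "z \<in> insert x F" "y \<noteq> z" "R y z" for y z
      using that c(2) k' sym[OF that(4)] by auto
  qed
qed

section \<open>Induced matchings as colour classes of the conflict relation\<close>

text \<open>For distinct edges of a graph this is exactly the obstruction to lying in a common
  induced matching: a shared vertex or an edge joining the two. Every nonempty edge conflicts with
  itself.\<close>

definition conflict :: "'a set set \<Rightarrow> 'a set \<Rightarrow> 'a set \<Rightarrow> bool" where
  "conflict E e f \<longleftrightarrow> (\<exists>x\<in>e. \<exists>y\<in>f. x = y \<or> {x, y} \<in> E)"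

lemma conflict_sym: "conflict E e f \<Longrightarrow> conflict E f e"
  unfolding conflict_def by (metis insert_commute)

text \<open>An edge \<open>g\<close> spanned by endpoints of \<open>M\<close> would itself put the
  members \<open>e\<close> and \<open>f\<close> containing its ends in conflict. Hence
  \<open>e = f\<close>, and \<open>g = e\<close> because both have two elements.\<close>

lemma induced_matching_if_no_conflict:
  assumes E: "E \<subseteq> nsets V 2" and "M \<subseteq> E"
    and free: "\<And>e f. e \<in> M \<Longrightarrow> f \<in> M \<Longrightarrow> e \<noteq> f \<Longrightarrow> \<not> conflict E e f"
  shows "induced_matching E M"
proof -
  have "g \<in> M" if "g \<in> E" "g \<subseteq> \<Union>M" for g
  proof -
    obtain x y where g: "g = {x, y}" "x \<noteq> y"
      using \<open>g \<in> E\<close> E by (meson nsets2_E subsetD)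
    then obtain e f where ef: "e \<in> M" "x \<in> e" "f \<in> M" "y \<in> f"
      using \<open>g \<subseteq> \<Union>M\<close> by auto
    then have "e = f"
      using free[of e f] \<open>g \<in> E\<close> g unfolding conflict_def by blast
    moreover obtain a b where "e = {a, b}"
      using ef(1) \<open>M \<subseteq> E\<close> E by (meson nsets2_E subsetD)
    ultimately have "g = e" using ef g by auto
    then show ?thesis using ef by simp
  qed
  moreover have "pairwise disjnt M"
    using free unfolding pairwise_def disjnt_iff conflict_def by blast
  ultimately show ?thesis
    using \<open>M \<subseteq> E\<close> unfolding induced_matching_def induced_edges_def by auto
qed

text \<open>Each label class is coloured separately by conflicts, and the matchings are the sets of
  edges with a given label and colour. This reduces both graphs to choosing labels and counting
  conflicts.\<close>

lemma decomposition_by_labels: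
  fixes E :: "'a set set" and lab :: "'a set \<Rightarrow> 'l"
  assumes "finite V" and E: "E \<subseteq> nsets V 2"
    and deg: "\<And>e. e \<in> E \<Longrightarrow> card {f \<in> E. lab f = lab e \<and> conflict E e f} \<le> K (lab e)"
  shows "\<exists>\<M>. induced_matching_decomposition E \<M> \<and> card \<M> \<le> (\<Sum>l\<in>lab ` E. K l)"
proof -
  have finE: "finite E"
    using assms(1) E finite_imp_finite_nsets finite_subset by blast
  have "\<exists>c. (\<forall>e\<in>{e \<in> E. lab e = l}. c e < K l) \<and>
      (\<forall>e\<in>{e \<in> E. lab e = l}. \<forall>f\<in>{e \<in> E. lab e = l}. e \<noteq> f \<longrightarrow> conflict E e f \<longrightarrow> c e \<noteq> c f)" for l
  proof (rule greedy_colouring)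
    show "finite {e \<in> E. lab e = l}" using finE by simp
    show "conflict E e f \<Longrightarrow> conflict E f e" for e f by (rule conflict_sym)
    fix e assume e: "e \<in> {e \<in> E. lab e = l}"
    then obtain x y where "e = {x, y}" using E by (auto elim!: nsets2_E dest!: subsetD)
    \<comment> \<open>The count in \<open>deg\<close> includes \<open>e\<close> itself; removing it
      gives the strict bound that greedy colouring requires.\<close>
    then have "conflict E e e" unfolding conflict_def by blast
    then have "{y \<in> {e \<in> E. lab e = l}. y \<noteq> e \<and> conflict E e y}
        \<subset> {f \<in> E. lab f = lab e \<and> conflict E e f}" using e by auto
    then have "card {y \<in> {e \<in> E. lab e = l}. y \<noteq> e \<and> conflict E e y}
        < card {f \<in> E. lab f = lab e \<and> conflict E e f}"
      by (rule psubset_card_mono[rotated]) (use finE in auto)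
    also have "\<dots> \<le> K l" using deg[of e] e by auto
    finally show "card {y \<in> {e \<in> E. lab e = l}. y \<noteq> e \<and> conflict E e y} < K l" .
  qed
  then obtain c where c: "\<And>l e. e \<in> E \<Longrightarrow> lab e = l \<Longrightarrow> c l e < K l"
      "\<And>l e f. e \<in> E \<Longrightarrow> lab e = l \<Longrightarrow> f \<in> E \<Longrightarrow> lab f = l \<Longrightarrow> e \<noteq> f \<Longrightarrow> conflict E e f
        \<Longrightarrow> c l e \<noteq> (c l f :: nat)"
    by simp metis
  define cls where "cls = (\<lambda>(l, i). {e \<in> E. lab e = l \<and> c l e = i})"
  define I where "I = Sigma (lab ` E) (\<lambda>l. {..<K l})"
  have finI: "finite I" unfolding I_def using finE by simp
  have "induced_matching_decomposition E (cls ` I)"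
    unfolding induced_matching_decomposition_def
  proof (intro conjI ballI)
    show "finite (cls ` I)" using finI by simp
    show "induced_matching E M" if "M \<in> cls ` I" for M
    proof (rule induced_matching_if_no_conflict[OF E])
      show "M \<subseteq> E" using that by (auto simp: cls_def)
      show "\<not> conflict E e f" if "e \<in> M" "f \<in> M" "e \<noteq> f" for e f
        using that \<open>M \<in> cls ` I\<close> c(2)[of e _ f] by (auto simp: cls_def)
    qed
    show "pairwise disjnt (cls ` I)"
      by (auto simp: pairwise_def disjnt_iff cls_def)
    have "e \<in> \<Union> (cls ` I)" if "e \<in> E" for e
      using that c(1)[OF that refl] by (auto simp: cls_def I_def)
    then show "\<Union> (cls ` I) = E" by (auto simp: cls_def)
  qed
  moreover have "card (cls ` I) \<le> (\<Sum>l\<in>lab ` E. K l)"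
    using card_image_le[OF finI, of cls] finE by (simp add: I_def)
  ultimately show ?thesis by blast
qed

section \<open>Graphs defined by Hamming distance\<close>

text \<open>Union minus intersection avoids ordering the two endpoints; on an edge it is the
  symmetric difference of the codes, so its cardinality is their Hamming distance.\<close>

definition edge_diff :: "('a \<Rightarrow> 'b set) \<Rightarrow> 'a set \<Rightarrow> 'b set" where
  "edge_diff \<phi> e = \<Union>(\<phi> ` e) - \<Inter>(\<phi> ` e)"

text \<open>Together with \<open>edge_diff\<close> this fixes the smallest subcube containing both
  codes; the edges sharing both labels are antipodal pairs of that subcube.\<close>

definition edge_meet :: "('a \<Rightarrow> 'b set) \<Rightarrow> 'a set \<Rightarrow> 'b set" where
  "edge_meet \<phi> e = \<Inter>(\<phi> ` e)"

lemma edge_diff_doubleton: "edge_diff \<phi> {a, b} = sym_diff (\<phi> a) (\<phi> b)"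
  by (auto simp: edge_diff_def)

lemma edge_meet_doubleton: "edge_meet \<phi> {a, b} = \<phi> a \<inter> \<phi> b"
  by (auto simp: edge_meet_def)

lemma edge_diff_subset:
  assumes "e \<in> nsets A 2" "\<phi> ` A \<subseteq> Pow B"
  shows "edge_diff \<phi> e \<subseteq> B"
  using assms unfolding edge_diff_def nsets_def by blast

lemma edge_through:
  assumes "e \<in> nsets A 2" "x \<in> e"
  obtains x' where "e = {x, x'}" "x \<in> A" "x' \<in> A" "x \<noteq> x'"
  using assms by (auto elim!: nsets2_E simp: insert_commute)

text \<open>Write v for the common difference. Exchanging the endpoint of \<open>e\<close> or of
  \<open>f\<close> changes \<open>u\<close> only by adding v, which leaves the unordered pair of
  codes of \<open>f\<close> unchanged. So \<open>f\<close> can be recovered from \<open>u\<close>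
  and one fixed endpoint \<open>a\<close> of \<open>e\<close>, whichever endpoints produced
  \<open>u\<close>.\<close>

lemma edge_eq_translate:
  assumes inj: "inj_on \<phi> A" and f: "f \<in> nsets A 2" "y \<in> f" and x: "e \<in> nsets A 2" "x \<in> e" "a \<in> e"
    and eq: "edge_diff \<phi> f = edge_diff \<phi> e"
    and u: "u = sym_diff (\<phi> x) (\<phi> y) \<or> u = sym_diff (sym_diff (\<phi> x) (\<phi> y)) (edge_diff \<phi> e)"
  shows "f = {c \<in> A. \<phi> c = sym_diff (\<phi> a) u \<or> \<phi> c = sym_diff (sym_diff (\<phi> a) u) (edge_diff \<phi> e)}"
proof -
  obtain y' where y': "f = {y, y'}" "y \<in> A" "y' \<in> A" using edge_through[OF f] by blast
  obtain x' where x': "e = {x, x'}" "x \<in> A" "x' \<in> A" using edge_through[OF x(1,2)] by blast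
  have d: "edge_diff \<phi> e = sym_diff (\<phi> x) (\<phi> x')" using x' edge_diff_doubleton by metis
  have "edge_diff \<phi> e = sym_diff (\<phi> y) (\<phi> y')" using y' edge_diff_doubleton eq by metis
  then have y'2: "\<phi> y' = sym_diff (\<phi> y) (edge_diff \<phi> e)" by blast
  have a: "\<phi> a = \<phi> x \<or> \<phi> a = sym_diff (\<phi> x) (edge_diff \<phi> e)" using x(3) d x' by auto
  have *: "{sym_diff (\<phi> a) u, sym_diff (sym_diff (\<phi> a) u) (edge_diff \<phi> e)} = {\<phi> y, \<phi> y'}"
  proof -
    have "sym_diff (\<phi> a) u = \<phi> y \<or> sym_diff (\<phi> a) u = \<phi> y'"
      using a u unfolding y'2 by (elim disjE) (simp; blast)+
    moreover have "sym_diff (\<phi> y') (edge_diff \<phi> e) = \<phi> y" unfolding y'2 by blast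
    ultimately show ?thesis using y'2 by auto
  qed
  have "f = {c \<in> A. \<phi> c \<in> {\<phi> y, \<phi> y'}}"
    using y' inj by (auto simp: inj_on_def)
  then show ?thesis unfolding *[symmetric] by simp
qed

text \<open>With \<open>a\<close> fixed, translation gives a single map \<open>g\<close> whose image
  of \<open>U\<close> covers \<open>F\<close>. Offering two candidates for membership in
  \<open>U\<close> lets the more convenient translation be used for each edge.\<close>

lemma card_conflicts_le:
  assumes inj: "inj_on \<phi> A" and e: "e \<in> nsets A 2" and finU: "finite U"
    and eq: "\<And>f. f \<in> F \<Longrightarrow> f \<in> nsets A 2 \<and> edge_diff \<phi> f = edge_diff \<phi> e"
    and U: "\<And>f. f \<in> F \<Longrightarrow> \<exists>x\<in>e. \<exists>y\<in>f. sym_diff (\<phi> x) (\<phi> y) \<in> U \<or>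
               sym_diff (sym_diff (\<phi> x) (\<phi> y)) (edge_diff \<phi> e) \<in> U"
  shows "card F \<le> card U"
proof -
  obtain a where a: "a \<in> e" using e by (auto elim!: nsets2_E)
  define g where "g = (\<lambda>u. {c \<in> A. \<phi> c = sym_diff (\<phi> a) u \<or>
      \<phi> c = sym_diff (sym_diff (\<phi> a) u) (edge_diff \<phi> e)})"
  have "F \<subseteq> g ` U"
  proof
    fix f assume f: "f \<in> F"
    from U[OF f] obtain x y u where "x \<in> e" "y \<in> f" "u \<in> U"
      "u = sym_diff (\<phi> x) (\<phi> y) \<or> u = sym_diff (sym_diff (\<phi> x) (\<phi> y)) (edge_diff \<phi> e)"
      by blast
    then show "f \<in> g ` U"
      using edge_eq_translate[OF inj _ _ e _ a, of f y x u] eq[OF f] unfolding g_def by blast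
  qed
  then have "card F \<le> card (g ` U)" using finU by (simp add: card_mono)
  also have "\<dots> \<le> card U" using finU by (rule card_image_le)
  finally show ?thesis .
qed

section \<open>Decomposing the near graph and the far graph\<close>

text \<open>The ball is counted twice: once for the differences that serve as labels, once for the
  translations between conflicting edges.\<close>

lemma near_decomposition:
  fixes \<phi> :: "'a \<Rightarrow> 'b set"
  assumes "finite A" and inj: "inj_on \<phi> A" and B: "finite B" "\<phi> ` A \<subseteq> Pow B" and "d > 0"
  defines "E \<equiv> {e \<in> nsets A 2. card (edge_diff \<phi> e) < d}"
  shows "\<exists>\<M>. induced_matching_decomposition E \<M> \<and> card \<M> \<le> (card {u \<in> Pow B. card u < d})\<^sup>2"
proof -
  let ?U = "{u \<in> Pow B. card u < d}"
  have E: "E \<subseteq> nsets A 2" unfolding E_def by blast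
  have sub: "sym_diff (\<phi> x) (\<phi> y) \<subseteq> B" if "x \<in> A" "y \<in> A" for x y
    using that B(2) by blast
  have "\<exists>\<M>. induced_matching_decomposition E \<M> \<and> card \<M> \<le> (\<Sum>l\<in>edge_diff \<phi> ` E. card ?U)"
  proof (rule decomposition_by_labels[OF assms(1) E])
    fix e assume e: "e \<in> E"
    show "card {f \<in> E. edge_diff \<phi> f = edge_diff \<phi> e \<and> conflict E e f} \<le> card ?U"
    proof (rule card_conflicts_le[OF inj])
      show "e \<in> nsets A 2" using e E by blast
      show "finite ?U" using B by simp
      fix f assume f: "f \<in> {f \<in> E. edge_diff \<phi> f = edge_diff \<phi> e \<and> conflict E e f}"
      then show "f \<in> nsets A 2 \<and> edge_diff \<phi> f = edge_diff \<phi> e" using E by blast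
      obtain x y where xy: "x \<in> e" "y \<in> f" "x = y \<or> {x, y} \<in> E"
        using f unfolding conflict_def by blast
      have "x \<in> A" "y \<in> A" using xy(1,2) e f E by (auto simp: nsets_def)
      \<comment> \<open>For \<open>x = y\<close> the difference is empty, and \<open>d > 0\<close>
        puts it into the ball.\<close>
      moreover have "card (sym_diff (\<phi> x) (\<phi> y)) < d"
        using xy(3) \<open>d > 0\<close> by (auto simp: E_def edge_diff_doubleton)
      ultimately have "sym_diff (\<phi> x) (\<phi> y) \<in> ?U" using sub by simp
      then show "\<exists>x\<in>e. \<exists>y\<in>f. sym_diff (\<phi> x) (\<phi> y) \<in> ?U \<or>
          sym_diff (sym_diff (\<phi> x) (\<phi> y)) (edge_diff \<phi> e) \<in> ?U"
        using xy by blast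
    qed
  qed
  then obtain \<M> where M: "induced_matching_decomposition E \<M>"
    "card \<M> \<le> (\<Sum>l\<in>edge_diff \<phi> ` E. card ?U)" by blast
  have "edge_diff \<phi> ` E \<subseteq> ?U"
    using edge_diff_subset[OF _ B(2)] by (auto simp: E_def)
  then have "card (edge_diff \<phi> ` E) \<le> card ?U"
    by (rule card_mono[rotated]) (use B in simp)
  then have "card \<M> \<le> (card ?U)\<^sup>2"
    using M(2) by (simp add: power2_eq_square) (meson le_trans mult_le_mono1)
  then show ?thesis using M by blast
qed

text \<open>The finer label costs a factor \<open>2 ^ card (B - v)\<close> in the number of classes,
  but confines translations to subsets of \<open>v\<close>. There complementation in
  \<open>v\<close> turns a large translation into a small one.\<close>

lemma far_decomposition:
  fixes \<phi> :: "'a \<Rightarrow> 'b set" and d :: nat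
  assumes "finite A" and inj: "inj_on \<phi> A" and B: "finite B" "\<phi> ` A \<subseteq> Pow B"
  defines "E \<equiv> {e \<in> nsets A 2. d \<le> card (edge_diff \<phi> e)}"
  shows "\<exists>\<M>. induced_matching_decomposition E \<M> \<and>
    card \<M> \<le> (\<Sum>v\<in>Pow B. 2 ^ card (B - v) * card {u \<in> Pow v. card u + d \<le> card v})"
proof -
  let ?U = "\<lambda>v. {u \<in> Pow v. card u + d \<le> card v}"
  let ?lab = "\<lambda>e. (edge_diff \<phi> e, edge_meet \<phi> e)"
  have E: "E \<subseteq> nsets A 2" unfolding E_def by blast
  have "\<exists>\<M>. induced_matching_decomposition E \<M> \<and> card \<M> \<le> (\<Sum>l\<in>?lab ` E. card (?U (fst l)))"
  proof (rule decomposition_by_labels[OF assms(1) E])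
    fix e assume e: "e \<in> E"
    have "edge_diff \<phi> e \<subseteq> B"
      using e edge_diff_subset[OF _ B(2)] by (simp add: E_def)
    then have finv: "finite (edge_diff \<phi> e)" using B(1) finite_subset by blast
    have "card {f \<in> E. ?lab f = ?lab e \<and> conflict E e f} \<le> card (?U (edge_diff \<phi> e))"
    proof (rule card_conflicts_le[OF inj])
      show "e \<in> nsets A 2" using e E by blast
      show "finite (?U (edge_diff \<phi> e))" using finv by simp
      fix f assume f: "f \<in> {f \<in> E. ?lab f = ?lab e \<and> conflict E e f}"
      then show "f \<in> nsets A 2 \<and> edge_diff \<phi> f = edge_diff \<phi> e" using E by blast
      obtain x y where xy: "x \<in> e" "y \<in> f" "x = y \<or> {x, y} \<in> E"
        using f unfolding conflict_def by blast
      define v where "v = edge_diff \<phi> e"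
      define u where "u = sym_diff (\<phi> x) (\<phi> y)"
      have "v = edge_diff \<phi> f" "edge_meet \<phi> f = edge_meet \<phi> e" using f by (auto simp: v_def)
      \<comment> \<open>Both codes lie between the common meet and its union with \<open>v\<close>,
        so they differ only inside \<open>v\<close>.\<close>
      then have "edge_meet \<phi> e \<subseteq> \<phi> x" "\<phi> x \<subseteq> edge_meet \<phi> e \<union> v"
        "edge_meet \<phi> e \<subseteq> \<phi> y" "\<phi> y \<subseteq> edge_meet \<phi> e \<union> v"
        using xy(1,2) by (auto simp: v_def edge_diff_def edge_meet_def)
      then have uv: "u \<subseteq> v" unfolding u_def by blast
      have "u \<in> ?U v \<or> sym_diff u v \<in> ?U v"
      \<comment> \<open>A shared vertex gives the empty translation, admissible since
        \<open>d \<le> card v\<close>; a joining edge makes \<open>u\<close> large, hence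
        \<open>v - u\<close> small.\<close>
      proof (cases "x = y")
        case True
        then show ?thesis using e by (simp add: u_def v_def E_def)
      next
        case False
        then have "d \<le> card u" using xy(3) by (simp add: E_def u_def edge_diff_doubleton)
        moreover have "card (v - u) = card v - card u" "card u \<le> card v"
          using uv finv by (auto simp: v_def card_Diff_subset finite_subset card_mono)
        moreover have "sym_diff u v = v - u" using uv by blast
        ultimately show ?thesis by auto
      qed
      then show "\<exists>x\<in>e. \<exists>y\<in>f. sym_diff (\<phi> x) (\<phi> y) \<in> ?U (edge_diff \<phi> e) \<or>
          sym_diff (sym_diff (\<phi> x) (\<phi> y)) (edge_diff \<phi> e) \<in> ?U (edge_diff \<phi> e)"
        using xy unfolding u_def v_def by blast
    qed
    then show "card {f \<in> E. ?lab f = ?lab e \<and> conflict E e f} \<le> card (?U (fst (?lab e)))"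
      by simp
  qed
  then obtain \<M> where M: "induced_matching_decomposition E \<M>"
    "card \<M> \<le> (\<Sum>l\<in>?lab ` E. card (?U (fst l)))" by blast
  have "?lab ` E \<subseteq> Sigma (Pow B) (\<lambda>v. Pow (B - v))"
  proof -
    have "edge_meet \<phi> e \<subseteq> B - edge_diff \<phi> e" if "e \<in> E" for e
    proof -
      have "e \<in> nsets A 2" using that E by blast
      then obtain x y where "e = {x, y}" "x \<in> A" "y \<in> A" by (rule nsets2_E)
      then have "\<phi> x \<subseteq> B" using B(2) by auto
      then show ?thesis unfolding \<open>e = {x, y}\<close> edge_diff_doubleton edge_meet_doubleton by blast
    qed
    then show ?thesis using edge_diff_subset[OF _ B(2)] by (auto simp: E_def)
  qed
  then have "(\<Sum>l\<in>?lab ` E. card (?U (fst l)))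
      \<le> (\<Sum>l\<in>Sigma (Pow B) (\<lambda>v. Pow (B - v)). card (?U (fst l)))"
    by (rule sum_mono2[rotated]) (use B in auto)
  also have "\<dots> = (\<Sum>v\<in>Pow B. \<Sum>I\<in>Pow (B - v). card (?U v))"
    by (subst sum.Sigma) (use B in \<open>auto simp: case_prod_unfold\<close>)
  also have "\<dots> = (\<Sum>v\<in>Pow B. 2 ^ card (B - v) * card (?U v))"
    using B by (intro sum.cong) (auto simp: card_Pow)
  finally show ?thesis using M by (meson le_trans)
qed

section \<open>Counting\<close>

text \<open>This is the binomial theorem over subsets: expand the product over \<open>B\<close> of
  the factors \<open>a + b\<close>.\<close>

lemma sum_Pow_power:
  fixes a b :: "'a::comm_semiring_1"
  assumes "finite B"
  shows "(\<Sum>u\<in>Pow B. a ^ card u * b ^ card (B - u)) = (a + b) ^ card B"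
  using prod_add[OF assms, of "\<lambda>_. a" "\<lambda>_. b"] by simp

text \<open>Give elements of \<open>u\<close> weight 2 and the others weight 3. A set smaller than
  \<open>d\<close> trades factors 2 for factors 3, so its weight is at least
  \<open>2 ^ d * 3 ^ (card B - d)\<close>. The ratio 2:3 approximates the ratio 7:11 of the later
  application.\<close>

lemma ball_bound:
  assumes "finite B" and "d \<le> card B"
  shows "2 ^ d * 3 ^ (card B - d) * card {u \<in> Pow B. card u < d} \<le> (5::nat) ^ card B"
proof -
  let ?U = "{u \<in> Pow B. card u < d}"
  have "2 ^ d * 3 ^ (card B - d) * card ?U = (\<Sum>u\<in>?U. 2 ^ d * (3::nat) ^ (card B - d))"
    by simp
  also have "\<dots> \<le> (\<Sum>u\<in>?U. 2 ^ card u * 3 ^ card (B - u))"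
  proof (rule sum_mono)
    fix u assume u: "u \<in> ?U"
    then have "card (B - u) = (d - card u) + (card B - d)"
      using assms by (simp add: card_Diff_subset finite_subset[of u B])
    moreover have "(2::nat) ^ d = 2 ^ card u * 2 ^ (d - card u)"
      using u by (simp flip: power_add)
    ultimately show "2 ^ d * (3::nat) ^ (card B - d) \<le> 2 ^ card u * 3 ^ card (B - u)"
      by (simp add: power_add power_mono)
  qed
  also have "\<dots> \<le> (\<Sum>u\<in>Pow B. 2 ^ card u * 3 ^ card (B - u))"
    by (rule sum_mono2) (use assms in auto)
  also have "\<dots> = 5 ^ card B" by (simp add: sum_Pow_power[OF assms(1)])
  finally show ?thesis .
qed

text \<open>In each pair of \<open>v\<close> and \<open>u\<close>, elements outside \<open>v\<close>
  have weight 2, those of \<open>u\<close> weight 1 and those of \<open>v - u\<close> weight 2. As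
  \<open>v - u\<close> has at least \<open>d\<close> elements, it supplies the factor
  \<open>2 ^ d\<close>; the total weight per element is 2 + 1 + 2 = 5.\<close>

lemma far_count_bound:
  assumes "finite B"
  shows "2 ^ d * (\<Sum>v\<in>Pow B. 2 ^ card (B - v) * card {u \<in> Pow v. card u + d \<le> card v})
    \<le> (5::nat) ^ card B"
proof -
  let ?U = "\<lambda>v. {u \<in> Pow v. card u + d \<le> card v}"
  have *: "2 ^ d * card (?U v) \<le> (3::nat) ^ card v" if "v \<in> Pow B" for v
  proof -
    have finv: "finite v" using that assms finite_subset by blast
    have "2 ^ d * card (?U v) = (\<Sum>u\<in>?U v. (2::nat) ^ d)" by simp
    also have "\<dots> \<le> (\<Sum>u\<in>?U v. 1 ^ card u * 2 ^ card (v - u))"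
    proof (rule sum_mono)
      fix u assume "u \<in> ?U v"
      then have "card u + d \<le> card v" "card (v - u) = card v - card u"
        using finv by (auto simp: card_Diff_subset finite_subset[of u v])
      then have "d \<le> card (v - u)" by simp
      then show "(2::nat) ^ d \<le> 1 ^ card u * 2 ^ card (v - u)" by simp
    qed
    also have "\<dots> \<le> (\<Sum>u\<in>Pow v. 1 ^ card u * 2 ^ card (v - u))"
      by (rule sum_mono2) (use finv in auto)
    also have "\<dots> = 3 ^ card v" unfolding sum_Pow_power[OF finv] by (simp add: numeral_3_eq_3)
    finally show ?thesis .
  qed
  have "2 ^ d * (\<Sum>v\<in>Pow B. 2 ^ card (B - v) * card (?U v))
      = (\<Sum>v\<in>Pow B. (2 ^ d * card (?U v)) * 2 ^ card (B - v))"
    by (simp add: sum_distrib_left mult_ac)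
  also have "\<dots> \<le> (\<Sum>v\<in>Pow B. 3 ^ card v * 2 ^ card (B - v))"
    by (intro sum_mono mult_right_mono *) auto
  also have "\<dots> = 5 ^ card B" by (simp add: sum_Pow_power[OF assms])
  finally show ?thesis .
qed

section \<open>Choice of parameters and assembly\<close>

text \<open>Since 34.8 = 174/5, fifth powers reduce the real bound to a comparison of
  integers.\<close>

lemma le_powr_if_power5_le:
  fixes x :: real
  assumes "0 \<le> x" "x ^ 5 \<le> 2 ^ (174 * m)"
  shows "x \<le> 2 powr (34.8 * real m)"
proof (rule power_le_imp_le_base)
  have "(2 powr (34.8 * real m)) ^ Suc 4 = 2 powr (34.8 * real m * 5)"
    by (simp add: powr_power)
  also have "\<dots> = 2 powr real (174 * m)" by simp
  also have "\<dots> = 2 ^ (174 * m)" by (rule powr_realpow) simp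
  finally show "x ^ Suc 4 \<le> (2 powr (34.8 * real m)) ^ Suc 4" using assms(2) by simp
qed simp

text \<open>Dimension \<open>18 * m\<close> and radius \<open>7 * m\<close> nearly balance the two
  bounds: the bases 5^18 / 2^7 and (5^18 / (2^7 3^11))^2 are about 2^34.795 and 2^34.720.\<close>

lemma two_graph_decomposition:
  assumes N: "N \<le> 2 ^ (18 * m)" and "m > 0"
  shows "\<exists>E\<^sub>1 E\<^sub>2 :: nat set set.
        E\<^sub>1 \<union> E\<^sub>2 = nsets {..<N} 2 \<and> E\<^sub>1 \<inter> E\<^sub>2 = {} \<and>
        (\<forall>E\<in>{E\<^sub>1, E\<^sub>2}. \<exists>\<M>. induced_matching_decomposition E \<M> \<and>
           real (card \<M>) \<le> 2 powr (34.8 * real m))"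
proof -
  let ?B = "{..<18 * m}"
  have "card {..<N} \<le> card (Pow ?B)" using N by (simp add: card_Pow)
  then obtain \<phi> where \<phi>: "\<phi> ` {..<N} \<subseteq> Pow ?B" "inj_on \<phi> {..<N}"
    using card_le_inj[of "{..<N}" "Pow ?B"] by auto
  define E\<^sub>1 where "E\<^sub>1 = {e \<in> nsets {..<N} 2. 7 * m \<le> card (edge_diff \<phi> e)}"
  define E\<^sub>2 where "E\<^sub>2 = {e \<in> nsets {..<N} 2. card (edge_diff \<phi> e) < 7 * m}"
  obtain \<M>\<^sub>1 where M1: "induced_matching_decomposition E\<^sub>1 \<M>\<^sub>1" "card \<M>\<^sub>1 \<le>
      (\<Sum>v\<in>Pow ?B. 2 ^ card (?B - v) * card {u \<in> Pow v. card u + 7 * m \<le> card v})"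
    using far_decomposition[OF _ \<phi>(2) _ \<phi>(1)] unfolding E\<^sub>1_def by blast
  have "2 ^ (7 * m) * card \<M>\<^sub>1 \<le> 5 ^ (18 * m)"
    using order_trans[OF mult_le_mono2[OF M1(2)] far_count_bound[of ?B "7 * m"]] by simp
  then have "(2 ^ (7 * m) * card \<M>\<^sub>1) ^ 5 \<le> (5 ^ (18 * m)) ^ 5"
    by (rule power_mono) simp
  also have "\<dots> = (5 ^ 90) ^ m" by (simp only: flip: power_mult) simp
  \<comment> \<open>Here 5^90 is just below 2^209, and 209 = 5 * 7 + 174.\<close>
  also have "\<dots> \<le> (2 ^ 209) ^ m" by (rule power_mono) simp_all
  also have "\<dots> = 2 ^ (35 * m) * 2 ^ (174 * m)" by (simp only: flip: power_mult power_add) simp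
  finally have "2 ^ (35 * m) * card \<M>\<^sub>1 ^ 5 \<le> 2 ^ (35 * m) * 2 ^ (174 * m)"
    by (simp add: power_mult_distrib mult.commute flip: power_mult)
  then have "card \<M>\<^sub>1 ^ 5 \<le> 2 ^ (174 * m)" by simp
  then have 1: "real (card \<M>\<^sub>1) \<le> 2 powr (34.8 * real m)"
    by (intro le_powr_if_power5_le) (simp_all flip: of_nat_power)
  define b where "b = card {u \<in> Pow ?B. card u < 7 * m}"
  obtain \<M>\<^sub>2 where M2: "induced_matching_decomposition E\<^sub>2 \<M>\<^sub>2" "card \<M>\<^sub>2 \<le> b\<^sup>2"
    using near_decomposition[OF _ \<phi>(2) _ \<phi>(1), of "7 * m"] \<open>m > 0\<close> unfolding E\<^sub>2_def b_def by auto
  have "2 ^ (7 * m) * 3 ^ (11 * m) * b \<le> 5 ^ (18 * m)"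
    using ball_bound[of ?B "7 * m"] by (simp add: b_def)
  \<comment> \<open>The tenth power is taken because the fifth power of the bound
    \<open>b\<^sup>2\<close> is needed. The exponent 244 below is 10 * 7 + 174.\<close>
  then have "(2 ^ (7 * m) * 3 ^ (11 * m) * b) ^ 10 \<le> (5 ^ (18 * m)) ^ 10"
    by (rule power_mono) simp
  also have "\<dots> = (5 ^ 180) ^ m" by (simp only: flip: power_mult) simp
  also have "\<dots> \<le> (3 ^ 110 * 2 ^ 244) ^ m" by (rule power_mono) simp_all
  also have "\<dots> = 2 ^ (70 * m) * 3 ^ (110 * m) * 2 ^ (174 * m)"
  proof -
    have "(2::nat) ^ (244 * m) = 2 ^ (70 * m) * 2 ^ (174 * m)"
      by (simp only: flip: power_add) simp
    then show ?thesis by (simp only: power_mult_distrib mult_ac flip: power_mult)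
  qed
  finally have "2 ^ (70 * m) * 3 ^ (110 * m) * b ^ 10 \<le> 2 ^ (70 * m) * 3 ^ (110 * m) * 2 ^ (174 * m)"
    by (simp add: power_mult_distrib mult.commute flip: power_mult)
  then have "b ^ 10 \<le> 2 ^ (174 * m)" by simp
  moreover have "card \<M>\<^sub>2 ^ 5 \<le> (b\<^sup>2) ^ 5" using M2(2) by (rule power_mono) simp
  ultimately have "card \<M>\<^sub>2 ^ 5 \<le> 2 ^ (174 * m)" by (simp flip: power_mult)
  then have 2: "real (card \<M>\<^sub>2) \<le> 2 powr (34.8 * real m)"
    by (intro le_powr_if_power5_le) (simp_all flip: of_nat_power)
  show ?thesis
  proof (intro exI conjI)
    show "E\<^sub>1 \<union> E\<^sub>2 = nsets {..<N} 2" "E\<^sub>1 \<inter> E\<^sub>2 = {}" by (auto simp: E\<^sub>1_def E\<^sub>2_def)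
    show "\<forall>E\<in>{E\<^sub>1, E\<^sub>2}. \<exists>\<M>. induced_matching_decomposition E \<M> \<and>
           real (card \<M>) \<le> 2 powr (34.8 * real m)"
      using M1(1) M2(1) 1 2 by blast
  qed
qed

theorem mainTheorem2:
  shows "\<exists>\<delta>::real. \<delta> > 0.058 \<and>
    (\<forall>\<^sub>F N::nat in sequentially.
      \<exists>E\<^sub>1 E\<^sub>2 :: nat set set.
        E\<^sub>1 \<union> E\<^sub>2 = nsets {..<N} 2 \<and> E\<^sub>1 \<inter> E\<^sub>2 = {} \<and>
        (\<forall>E\<in>{E\<^sub>1, E\<^sub>2}. \<exists>\<M>. induced_matching_decomposition E \<M> \<and>
           real (card \<M>) \<le> real N powr (2 - \<delta>)))"
proof (intro exI conjI)
  \<comment> \<open>The construction has exponent 34.8/18 = 1.9333..., so 0.06 leaves room below 2 -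
    34.8/18 = 0.0666... for rounding.\<close>
  show "(0.058::real) < 0.06" by simp
  have "\<exists>E\<^sub>1 E\<^sub>2 :: nat set set.
        E\<^sub>1 \<union> E\<^sub>2 = nsets {..<N} 2 \<and> E\<^sub>1 \<inter> E\<^sub>2 = {} \<and>
        (\<forall>E\<in>{E\<^sub>1, E\<^sub>2}. \<exists>\<M>. induced_matching_decomposition E \<M> \<and>
           real (card \<M>) \<le> real N powr (2 - 0.06))"
    if "2 ^ 5220 \<le> N" for N
  proof -
    define L where "L = log 2 (real N)"
    have "real (2 ^ 5220) \<le> real N" using that by (rule of_nat_mono)
    then have pow: "(2::real) ^ 5220 \<le> real N" by (simp only: of_nat_power of_nat_numeral)
    have N0: "real N > 0" by (rule less_le_trans[OF _ pow]) (rule zero_less_power, simp)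
    have L: "L \<ge> 5220"
      using pow N0 unfolding L_def by (subst le_log_iff) (simp_all add: powr_numeral del: power_numeral)
    have NL: "real N = 2 powr L" using N0 by (simp add: L_def)
    \<comment> \<open>Rounding up makes the cube large enough for \<open>N\<close> vertices and
      costs at most one in \<open>m\<close>.\<close>
    define m where "m = nat \<lceil>L / 18\<rceil>"
    have m: "L / 18 \<le> real m" "real m \<le> L / 18 + 1" using L unfolding m_def by linarith+
    have "m > 0" using m L by (cases m) auto
    have "real N \<le> 2 powr real (18 * m)" unfolding NL using m by (intro powr_mono) auto
    also have "\<dots> = real (2 ^ (18 * m))" by (subst powr_realpow) simp_all
    finally have "N \<le> 2 ^ (18 * m)" by (simp only: of_nat_le_iff)
    note dec = two_graph_decomposition[OF this \<open>m > 0\<close>]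
    \<comment> \<open>From \<open>m \<le> L / 18 + 1\<close> the exponent is at most (34.8/18) L +
      34.8. As 34.8/18 = 1.94 - 1/150, this is at most 1.94 L once L is at least 150 * 34.8 = 5220,
      whence the threshold.\<close>
    have "2 powr (34.8 * real m) \<le> (2::real) powr (L * (2 - 0.06))"
      using m L by (intro powr_mono) auto
    also have "\<dots> = real N powr (2 - 0.06)" unfolding NL by (simp only: powr_powr)
    finally show ?thesis using dec by (meson order_trans)
  qed
  then show "\<forall>\<^sub>F N::nat in sequentially. \<exists>E\<^sub>1 E\<^sub>2 :: nat set set.
        E\<^sub>1 \<union> E\<^sub>2 = nsets {..<N} 2 \<and> E\<^sub>1 \<inter> E\<^sub>2 = {} \<and>
        (\<forall>E\<in>{E\<^sub>1, E\<^sub>2}. \<exists>\<M>. induced_matching_decomposition E \<M> \<and>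
           real (card \<M>) \<le> real N powr (2 - 0.06))"
    by (rule eventually_sequentiallyI)
qed

end
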